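(* Let $M,N,K$ be positive integers with $N\le M$, let $\boldsymbol{H}\in\mathbb{C}^{M\times N}$, $\boldsymbol{A}\in\mathbb{C}^{M\times K}$, and let $\mathcal{F}(\boldsymbol{W})=\frac12\|\boldsymbol{H}\boldsymbol{W}-\boldsymbol{A}\|_F^2$ for $\boldsymbol{W}\in\mathbb{C}^{N\times K}$. Let $L>0$ be a Lipschitz constant of $\mathcal{F}$ (in the sense given in the context), and let the sequence $(\boldsymbol{W}^t)_{t\ge 0}$ in $\mathbb{C}^{N\times K}$ be generated from an arbitrary $\boldsymbol{W}^0$ by the gradient descent iteration $$\boldsymbol{W}^{t+1}=\boldsymbol{W}^t-\alpha\nabla\mathcal{F}(\boldsymbol{W}^t).$$ If the step size satisfies $\alpha\in(0,2/L)$, then $(\boldsymbol{W}^t)$ converges to an optimal solution of the unconstrained problem $\min_{\boldsymbol{W}\in\mathbb{C}^{N\times K}}\mathcal{F}(\boldsymbol{W})$, and for every $t\ge 0$ $$\mathcal{F}(\boldsymbol{W}^{t})-\mathcal{F}(\boldsymbol{W}^{t+1})\ge \alpha\Big(1-\frac{\alpha L}{2}\Big)\|\nabla\mathcal{F}(\boldsymbol{W}^{t})\|_F^2.$$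
   Context: $\|\cdot\|_F$ is the Frobenius norm, $(\cdot)^H$ the Hermitian transpose, and $\mathrm{Re}[\boldsymbol{X},\boldsymbol{Y}]_F=\mathrm{Re}\,\mathrm{tr}(\boldsymbol{X}^H\boldsymbol{Y})$ the real part of the Frobenius inner product. The complex gradient is $\nabla\mathcal{F}(\boldsymbol{W})=\boldsymbol{H}^H\boldsymbol{H}\boldsymbol{W}-\boldsymbol{H}^H\boldsymbol{A}$. A constant $L>0$ is a Lipschitz constant of $\mathcal{F}$ if for all $\boldsymbol{X},\boldsymbol{Y}\in\mathbb{C}^{N\times K}$ $$\mathcal{F}(\boldsymbol{Y})\le\mathcal{F}(\boldsymbol{X})+\mathrm{Re}[\nabla\mathcal{F}(\boldsymbol{X}),\boldsymbol{Y}-\boldsymbol{X}]_F+\frac{L}{2}\|\boldsymbol{Y}-\boldsymbol{X}\|_F^2 .$$ *)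

theory Defs
  imports "HOL-Analysis.Analysis"
begin

(* An M x N complex matrix has type complex^'n^'m, where CARD('m) = M and CARD('n) = N.
   The library's norm on this type is the Frobenius norm: *)
lemma norm_matrix_eq_frobenius:
  fixes A :: "complex^'n^'m"
  shows "norm A = sqrt (\<Sum>i\<in>UNIV. \<Sum>j\<in>UNIV. (cmod (A $ i $ j))\<^sup>2)"
  by (simp add: norm_vec_def L2_set_def sum_nonneg)

definition conj_transpose :: "complex^'n^'m \<Rightarrow> complex^'m^'n" where
  "conj_transpose A = (\<chi> i j. cnj (A $ j $ i))"

definition re_frob_inner :: "complex^'k^'n \<Rightarrow> complex^'k^'n \<Rightarrow> real" where
  "re_frob_inner X Y = Re (trace (conj_transpose X ** Y))"

definition ls_objective ::
    "complex^'n^'m \<Rightarrow> complex^'k^'m \<Rightarrow> complex^'k^'n \<Rightarrow> real" where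
  "ls_objective H A W = 1 / 2 * (norm (H ** W - A))\<^sup>2"

definition ls_gradient ::
    "complex^'n^'m \<Rightarrow> complex^'k^'m \<Rightarrow> complex^'k^'n \<Rightarrow> complex^'k^'n" where
  "ls_gradient H A W = conj_transpose H ** H ** W - conj_transpose H ** A"

(* "Lipschitz constant" is meant in the sense of the quadratic upper bound (descent lemma),
   for an objective F with gradient G. *)
definition lipschitz_const ::
    "(complex^'k^'n \<Rightarrow> real) \<Rightarrow> (complex^'k^'n \<Rightarrow> complex^'k^'n) \<Rightarrow> real \<Rightarrow> bool" where
  "lipschitz_const F G L \<longleftrightarrow>
     L > 0 \<and>
     (\<forall>X Y. F Y \<le> F X + re_frob_inner (G X) (Y - X) + L / 2 * (norm (Y - X))\<^sup>2)"

end

theory Submission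
  imports Defs
begin

text \<open>
  The convergence statement is a property of gradient descent on any convex function \<open>F\<close> that
  satisfies the quadratic upper bound with constant \<open>L\<close> and attains its minimum. Three facts
  carry it.

  \<^item> Substituting a gradient step into the upper bound gives the claimed decrease of \<open>F\<close>
    (\<open>descent_step\<close>). As \<open>F\<close> is bounded below, these decreases tend to zero, and so do the
    gradients along the iteration.

  \<^item> Convexity together with the upper bound makes the gradient co-coercive (\<open>cocoercive\<close>).
    A step with \<open>0 < \<alpha> < 2 / L\<close> therefore never moves away from \<^emph>\<open>any\<close> minimiser
    (\<open>step_not_farther\<close>), and in particular the iterates stay bounded.

  \<^item> By compactness some subsequence converges. Its limit has zero gradient, so it is itself a
    minimiser, and the distance of the iterates to it is nonincreasing and has a null
    subsequence: the whole sequence converges to it. This is what allows a single limit even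
    though the minimiser need not be unique.

  For least squares, expanding the square shows that \<open>F Y\<close> exceeds its linearisation at \<open>X\<close> by
  exactly half the squared norm of \<open>H (Y - X)\<close>; this is nonnegative, so \<open>F\<close> is convex. A
  minimiser exists because the matrices \<open>H W\<close> form a subspace of finite dimension, hence a closed
  set, in which \<open>A\<close> has a nearest point.
\<close>

section \<open>Gradient descent on smooth convex functions\<close>

text \<open>
  The gradient \<open>G\<close> enters only through the two first-order inequalities, so no derivative has to
  be computed in order to instantiate the locale.
\<close>

locale smooth_convex =
  fixes F :: "'a::euclidean_space \<Rightarrow> real" and G :: "'a \<Rightarrow> 'a" and L :: real
  assumes L_pos: "L > 0"
    and convex_below: "\<And>X Y. F X + G X \<bullet> (Y - X) \<le> F Y"
    and smooth_above: "\<And>X Y. F Y \<le> F X + G X \<bullet> (Y - X) + L / 2 * (norm (Y - X))\<^sup>2"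
begin

lemma descent_step:
  "F X - F (X - \<alpha> *\<^sub>R G X) \<ge> \<alpha> * (1 - \<alpha> * L / 2) * (norm (G X))\<^sup>2"
  using smooth_above[of "X - \<alpha> *\<^sub>R G X" X]
  by (simp add: dot_square_norm power_mult_distrib power2_eq_square algebra_simps)

lemma zero_gradient_iff_minimiser: "G V = 0 \<longleftrightarrow> (\<forall>U. F V \<le> F U)"
proof
  assume "G V = 0"
  then show "\<forall>U. F V \<le> F U"
    using convex_below[of V] by simp
next
  assume "\<forall>U. F V \<le> F U"
  then have "F V \<le> F (V - (1 / L) *\<^sub>R G V)"
    by blast
  with descent_step[of "1 / L" V] L_pos have "(norm (G V))\<^sup>2 / (2 * L) \<le> 0"
    by simp
  with L_pos show "G V = 0"
    by (simp add: divide_le_0_iff)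
qed

text \<open>
  The tilted function \<open>\<lambda>Z. F Z - G X \<bullet> Z\<close> is minimised at \<open>X\<close> by convexity and has gradient
  \<open>G Y - G X\<close> at \<open>Y\<close>. A step of length \<open>1 / L\<close> from \<open>Y\<close> lowers it by at least the squared norm of
  that gradient over \<open>2 * L\<close>, and cannot go below the value at \<open>X\<close>.
\<close>

lemma convex_below_strong:
  "F X + G X \<bullet> (Y - X) + (norm (G Y - G X))\<^sup>2 / (2 * L) \<le> F Y"
proof -
  define D where "D = G Y - G X"
  define Z where "Z = Y - (1 / L) *\<^sub>R D"
  have "F X + G X \<bullet> (Z - X) \<le> F Z"
    by (rule convex_below)
  also have "\<dots> \<le> F Y + G Y \<bullet> (Z - Y) + L / 2 * (norm (Z - Y))\<^sup>2"
    by (rule smooth_above)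
  also have "L / 2 * (norm (Z - Y))\<^sup>2 = D \<bullet> D / (2 * L)"
    using L_pos by (simp add: Z_def power_divide power2_eq_square dot_square_norm)
  also have "G Y \<bullet> (Z - Y) = - (G Y \<bullet> D / L)"
    by (simp add: Z_def)
  finally have "F X + G X \<bullet> (Y - X) - G X \<bullet> D / L \<le> F Y - G Y \<bullet> D / L + D \<bullet> D / (2 * L)"
    by (simp add: Z_def inner_diff_right)
  moreover have "G Y \<bullet> D / L - G X \<bullet> D / L = D \<bullet> D / L"
    by (simp add: D_def inner_diff_left diff_divide_distrib)
  moreover have "D \<bullet> D / L = 2 * (D \<bullet> D / (2 * L))"
    by simp
  ultimately show ?thesis
    by (simp add: D_def dot_square_norm)
qed

text \<open>The co-coercivity of Baillon and Haddad: add the strong inequality to its mirror image.\<close>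

lemma cocoercive: "(norm (G X - G Y))\<^sup>2 \<le> L * ((G X - G Y) \<bullet> (X - Y))"
proof -
  have "(norm (G X - G Y))\<^sup>2 / (2 * L) + (norm (G X - G Y))\<^sup>2 / (2 * L) \<le> (G X - G Y) \<bullet> (X - Y)"
    using convex_below_strong[of X Y] convex_below_strong[of Y X]
    by (simp add: norm_minus_commute algebra_simps)
  then show ?thesis
    using L_pos by (simp add: field_simps)
qed

lemma gradient_lipschitz: "norm (G X - G Y) \<le> L * norm (X - Y)"
proof -
  have "(norm (G X - G Y))\<^sup>2 \<le> L * (norm (G X - G Y) * norm (X - Y))"
    using cocoercive[of X Y] norm_cauchy_schwarz[of "G X - G Y" "X - Y"] L_pos
    by (meson less_imp_le mult_left_mono order_trans)
  then have "norm (G X - G Y) * norm (G X - G Y) \<le> norm (G X - G Y) * (L * norm (X - Y))"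
    by (simp add: power2_eq_square algebra_simps)
  then show ?thesis
    using L_pos by (cases "G X = G Y") (auto simp: mult_le_cancel_left)
qed

lemma continuous_gradient: "continuous_on UNIV G"
proof -
  have "L-lipschitz_on UNIV G"
    using gradient_lipschitz L_pos by (intro lipschitz_onI) (auto simp: dist_norm)
  then show ?thesis
    by (rule lipschitz_on_continuous_on)
qed

text \<open>
  Expanding the square, the squared distance changes by
  \<open>\<alpha>\<^sup>2 * (norm (G X))\<^sup>2 - 2 * \<alpha> * (G X \<bullet> (X - V))\<close>, which co-coercivity bounds by a nonnegative multiple of
  \<open>\<alpha> * L - 2\<close>. The range of step sizes is the one that makes this nonpositive.
\<close>

lemma step_not_farther:
  assumes \<alpha>: "0 \<le> \<alpha>" "\<alpha> \<le> 2 / L" and V: "G V = 0"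
  shows "norm (X - \<alpha> *\<^sub>R G X - V) \<le> norm (X - V)"
proof -
  have "\<alpha> * L \<le> 2"
    using \<alpha> L_pos by (simp add: field_simps)
  have co: "(norm (G X))\<^sup>2 \<le> L * (G X \<bullet> (X - V))"
    using cocoercive[of X V] V by simp
  then have "0 \<le> L * (G X \<bullet> (X - V))"
    by (rule order_trans[OF zero_le_power2])
  then have nonneg: "0 \<le> G X \<bullet> (X - V)"
    using L_pos by (simp add: zero_le_mult_iff)
  have "\<alpha> * (norm (G X))\<^sup>2 \<le> (\<alpha> * L) * (G X \<bullet> (X - V))"
    using mult_left_mono[OF co \<open>0 \<le> \<alpha>\<close>] by (simp add: mult.assoc)
  also have "\<dots> \<le> 2 * (G X \<bullet> (X - V))"
    using \<open>\<alpha> * L \<le> 2\<close> nonneg by (rule mult_right_mono)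
  finally have "\<alpha> * (\<alpha> * (norm (G X))\<^sup>2) \<le> \<alpha> * (2 * (G X \<bullet> (X - V)))"
    using \<open>0 \<le> \<alpha>\<close> by (rule mult_left_mono)
  moreover have "X - \<alpha> *\<^sub>R G X - V = (X - V) - \<alpha> *\<^sub>R G X"
    by simp
  then have "(norm (X - \<alpha> *\<^sub>R G X - V))\<^sup>2
      = (norm (X - V))\<^sup>2 - 2 * \<alpha> * (G X \<bullet> (X - V)) + \<alpha> * (\<alpha> * (norm (G X))\<^sup>2)"
    unfolding power2_norm_eq_inner
    by (simp only:) (simp add: inner_diff_left inner_diff_right inner_commute algebra_simps)
  ultimately have "(norm (X - \<alpha> *\<^sub>R G X - V))\<^sup>2 \<le> (norm (X - V))\<^sup>2"
    by simp
  then show ?thesis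
    by (rule power2_le_imp_le) simp
qed

theorem gradient_descent_converges:
  assumes \<alpha>: "0 < \<alpha>" "\<alpha> < 2 / L"
    and step: "\<And>t. W (Suc t) = W t - \<alpha> *\<^sub>R G (W t)"
    and minimum: "\<forall>U. F V\<^sub>0 \<le> F U"
  shows "\<exists>V. W \<longlonglongrightarrow> V \<and> (\<forall>U. F V \<le> F U)"
proof -
  define c where "c = \<alpha> * (1 - \<alpha> * L / 2)"
  have "c > 0"
    using \<alpha> L_pos by (simp add: c_def field_simps)

  have decrease: "c * (norm (G (W t)))\<^sup>2 \<le> F (W t) - F (W (Suc t))" for t
    using descent_step[of \<alpha> "W t"] by (simp add: step c_def)
  have "F (W (Suc t)) \<le> F (W t)" for t
  proof -
    have "0 \<le> c * (norm (G (W t)))\<^sup>2"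
      using \<open>c > 0\<close> by simp
    with decrease[of t] show ?thesis by simp
  qed
  then have "decseq (\<lambda>t. F (W t))"
    by (intro decseq_SucI)
  then obtain l where l: "(\<lambda>t. F (W t)) \<longlonglongrightarrow> l"
    using decseq_convergent[of "\<lambda>t. F (W t)" "F V\<^sub>0"] minimum by blast
  have "(\<lambda>t. F (W t) - F (W (Suc t))) \<longlonglongrightarrow> l - l"
    using l by (intro tendsto_diff LIMSEQ_Suc)
  then have "(\<lambda>t. F (W t) - F (W (Suc t))) \<longlonglongrightarrow> 0"
    by simp
  then have "(\<lambda>t. c * (norm (G (W t)))\<^sup>2) \<longlonglongrightarrow> 0"
  proof (rule tendsto_sandwich[rotated 3])
    show "(\<lambda>_. 0) \<longlonglongrightarrow> (0 :: real)"
      by (rule tendsto_const)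
    show "\<forall>\<^sub>F t in sequentially. 0 \<le> c * (norm (G (W t)))\<^sup>2"
      using \<open>c > 0\<close> by simp
    show "\<forall>\<^sub>F t in sequentially. c * (norm (G (W t)))\<^sup>2 \<le> F (W t) - F (W (Suc t))"
      using decrease by simp
  qed
  from tendsto_mult_left[OF this, of "1 / c"] have "(\<lambda>t. (norm (G (W t)))\<^sup>2) \<longlonglongrightarrow> 0"
    using \<open>c > 0\<close> by simp
  from tendsto_real_sqrt[OF this] have gradients_null: "(\<lambda>t. G (W t)) \<longlonglongrightarrow> 0"
    by (simp add: tendsto_norm_zero_iff)

  have closer: "decseq (\<lambda>t. norm (W t - V))" if "G V = 0" for V
    using that \<alpha> by (intro decseq_SucI) (simp add: step step_not_farther)

  have "G V\<^sub>0 = 0"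
    using minimum zero_gradient_iff_minimiser by blast
  then have "norm (W t - V\<^sub>0) \<le> norm (W 0 - V\<^sub>0)" for t
    using decseqD[OF closer, of V\<^sub>0 0 t] by simp
  then have "range W \<subseteq> cball V\<^sub>0 (norm (W 0 - V\<^sub>0))"
    by (auto simp: dist_norm norm_minus_commute)
  then have "bounded (range W)"
    using bounded_cball bounded_subset by blast
  then obtain V r where r: "strict_mono r" and sub: "(W \<circ> r) \<longlonglongrightarrow> V"
    using bounded_imp_convergent_subsequence by blast

  have "(\<lambda>n. G ((W \<circ> r) n)) \<longlonglongrightarrow> G V"
    by (rule continuous_on_tendsto_compose[OF continuous_gradient sub]) auto
  moreover have "(\<lambda>n. G ((W \<circ> r) n)) \<longlonglongrightarrow> 0"
    using LIMSEQ_subseq_LIMSEQ[OF gradients_null r] by (simp add: o_def)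
  ultimately have "G V = 0"
    by (rule LIMSEQ_unique)

  \<comment> \<open>The distances to \<open>V\<close> converge, so the subsequence already determines their limit.\<close>
  obtain d where d: "(\<lambda>t. norm (W t - V)) \<longlonglongrightarrow> d"
    using decseq_convergent[OF closer[OF \<open>G V = 0\<close>], of 0] by auto
  have "(\<lambda>n. norm ((W \<circ> r) n - V)) \<longlonglongrightarrow> 0"
    using sub by (metis LIM_zero tendsto_norm_zero)
  moreover have "(\<lambda>n. norm ((W \<circ> r) n - V)) \<longlonglongrightarrow> d"
    using LIMSEQ_subseq_LIMSEQ[OF d r] by (simp add: o_def)
  ultimately have "d = 0"
    using LIMSEQ_unique by blast
  with d have "W \<longlonglongrightarrow> V"
    by (metis LIM_zero_cancel tendsto_norm_zero_cancel)
  with \<open>G V = 0\<close> show ?thesis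
    using zero_gradient_iff_minimiser by blast
qed

end

section \<open>Least squares over complex matrices\<close>

text \<open>
  The type of complex matrices is a real Euclidean space, and its inner product is the real part
  of the Frobenius inner product; this makes the results above applicable.
\<close>

lemma re_frob_inner_eq_inner: "re_frob_inner X Y = X \<bullet> Y"
proof -
  have "re_frob_inner X Y = (\<Sum>i\<in>UNIV. \<Sum>k\<in>UNIV. X $ k $ i \<bullet> Y $ k $ i)"
    by (simp add: re_frob_inner_def trace_def matrix_matrix_mult_def conj_transpose_def
        inner_complex_def)
  also have "\<dots> = X \<bullet> Y"
    by (subst sum.swap) (simp add: inner_vec_def)
  finally show ?thesis .
qed

lemma conj_transpose_mult:
  "conj_transpose (A ** B) = conj_transpose B ** conj_transpose A"
  by (simp add: conj_transpose_def matrix_matrix_mult_def vec_eq_iff mult.commute)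

lemma conj_transpose_conj_transpose: "conj_transpose (conj_transpose A) = A"
  by (simp add: conj_transpose_def vec_eq_iff)

lemma inner_conj_transpose_mult: "(conj_transpose H ** B) \<bullet> X = B \<bullet> (H ** X)"
  by (simp add: re_frob_inner_def conj_transpose_mult conj_transpose_conj_transpose
      matrix_mul_assoc flip: re_frob_inner_eq_inner)

lemma linear_matrix_mult_left: "linear ((**) (H :: complex^'n^'m))"
  by (rule linearI)
    (simp_all add: matrix_matrix_mult_def vec_eq_iff sum.distrib scaleR_sum_right algebra_simps)

lemma ls_gradient_eq: "ls_gradient H A X = conj_transpose H ** (H ** X - A)"
  by (simp add: ls_gradient_def linear_diff[OF linear_matrix_mult_left] matrix_mul_assoc)

lemma ls_objective_expansion:
  "ls_objective H A Y
    = ls_objective H A X + ls_gradient H A X \<bullet> (Y - X) + 1 / 2 * (norm (H ** (Y - X)))\<^sup>2"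
proof -
  have residual: "H ** Y - A = (H ** X - A) + H ** (Y - X)"
    by (simp add: linear_diff[OF linear_matrix_mult_left])
  show ?thesis
    unfolding ls_objective_def residual ls_gradient_eq inner_conj_transpose_mult
    by (simp add: power2_norm_eq_inner inner_add_left inner_add_right inner_commute
        algebra_simps)
qed

lemma ls_objective_attains_minimum:
  fixes H :: "complex^'n^'m" and A :: "complex^'k^'m"
  shows "\<exists>V. \<forall>U. ls_objective H A V \<le> ls_objective H A U"
proof -
  define S where "S = range ((**) H :: complex^'k^'n \<Rightarrow> complex^'k^'m)"
  have "closed S"
    unfolding S_def
    by (intro closed_subspace linear_subspace_image linear_matrix_mult_left subspace_UNIV)
  moreover have "S \<noteq> {}"
    by (simp add: S_def)
  ultimately obtain B where "B \<in> S" and nearest: "\<And>C. C \<in> S \<Longrightarrow> dist A B \<le> dist A C"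
    using distance_attains_inf[of S A] by metis
  then obtain V where "B = H ** V"
    by (auto simp: S_def)
  then have "norm (H ** V - A) \<le> norm (H ** U - A)" for U
    using nearest[of "H ** U"] by (simp add: S_def dist_norm norm_minus_commute)
  then have "\<forall>U. ls_objective H A V \<le> ls_objective H A U"
    by (simp add: ls_objective_def power_mono)
  then show ?thesis ..
qed

lemma smooth_convex_ls_objective:
  assumes "lipschitz_const (ls_objective H A) (ls_gradient H A) L"
  shows "smooth_convex (ls_objective H A) (ls_gradient H A) L"
proof
  show "L > 0"
    using assms by (simp add: lipschitz_const_def)
  show "ls_objective H A X + ls_gradient H A X \<bullet> (Y - X) \<le> ls_objective H A Y" for X Y
    using ls_objective_expansion[of H A Y X] by simp
  show "ls_objective H A Y
      \<le> ls_objective H A X + ls_gradient H A X \<bullet> (Y - X) + L / 2 * (norm (Y - X))\<^sup>2" for X Y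
    using assms by (simp add: lipschitz_const_def re_frob_inner_eq_inner)
qed

theorem theorem2:
  fixes H :: "complex^'n^'m"
    and A :: "complex^'k^'m"
    and W :: "nat \<Rightarrow> complex^'k^'n"
    and L \<alpha> :: real
  assumes "CARD('n) \<le> CARD('m)"
    and "lipschitz_const (ls_objective H A) (ls_gradient H A) L"
    and "\<And>t. W (Suc t) = W t - \<alpha> *\<^sub>R ls_gradient H A (W t)"
    and "\<alpha> \<in> {0<..<2 / L}"
  shows "(\<exists>V. W \<longlonglongrightarrow> V \<and> (\<forall>U. ls_objective H A V \<le> ls_objective H A U)) \<and>
    (\<forall>t. ls_objective H A (W t) - ls_objective H A (W (Suc t))
          \<ge> \<alpha> * (1 - \<alpha> * L / 2) * (norm (ls_gradient H A (W t)))\<^sup>2)"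
proof -
  interpret smooth_convex "ls_objective H A" "ls_gradient H A" L
    using assms(2) by (rule smooth_convex_ls_objective)
  obtain V\<^sub>0 where "\<forall>U. ls_objective H A V\<^sub>0 \<le> ls_objective H A U"
    using ls_objective_attains_minimum[of H A] by blast
  then have "\<exists>V. W \<longlonglongrightarrow> V \<and> (\<forall>U. ls_objective H A V \<le> ls_objective H A U)"
    using assms(3,4) by (intro gradient_descent_converges) auto
  moreover have "\<forall>t. ls_objective H A (W t) - ls_objective H A (W (Suc t))
      \<ge> \<alpha> * (1 - \<alpha> * L / 2) * (norm (ls_gradient H A (W t)))\<^sup>2"
    unfolding assms(3) using descent_step by blast
  ultimately show ?thesis ..
qed

end
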